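(* Assume the ABC conjecture. Then there is an absolute constant $C$ such that $$Q_k(N)\le N^{1/k}\exp\Big(Ck\frac{\log N}{\log\log N}\Big)$$ holds for all $k\ge4$ and $N\ge1$.
   Context: For $k\ge2$, $N,q\ge1$ and $a\in\mathbb{Z}$, $Q_k(N;q,a)$ is the number of $k$-th powers in the arithmetic progression $a+q,a+2q,\dots,a+Nq$, and $Q_k(N)=\max_{q\ge1,\,a\ge0}Q_k(N;q,a)$. The ABC conjecture: for each $\varepsilon>0$ there is $K_\varepsilon$ such that whenever $a,b,c$ are nonzero integers with $\gcd(a,b,c)=1$ and $a+b=c$, $\max\{|a|,|b|,|c|\}\le K_\varepsilon\operatorname{rad}(abc)^{1+\varepsilon}$, where $\operatorname{rad}(n)=\prod_{p\mid n}p$.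
   Formalization: For N = 1 and N = 2, log log N is read as 1, since it is undefined at N = 1 and negative at N = 2, where the literal bound fails because Q_k(2) = 2; for all N ≥ 3 the bound is as stated. *)

theory Defs
  imports Complex_Main "HOL-Computational_Algebra.Primes" "HOL-Computational_Algebra.Nth_Powers"
begin

definition rad :: "int \<Rightarrow> int" where
  "rad n = (\<Prod>p\<in>prime_factors n. p)"

definition abc_conjecture :: bool where
  "abc_conjecture \<longleftrightarrow>
     (\<forall>\<epsilon>::real. \<epsilon> > 0 \<longrightarrow>
        (\<exists>K::real. \<forall>a b c :: int.
           a \<noteq> 0 \<longrightarrow> b \<noteq> 0 \<longrightarrow> c \<noteq> 0 \<longrightarrow> Gcd {a, b, c} = 1 \<longrightarrow> a + b = c \<longrightarrow>
             real_of_int (Max {\<bar>a\<bar>, \<bar>b\<bar>, \<bar>c\<bar>})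
               \<le> K * real_of_int (rad (a * b * c)) powr (1 + \<epsilon>)))"

definition kth_powers_in_AP :: "nat \<Rightarrow> nat \<Rightarrow> nat \<Rightarrow> int \<Rightarrow> nat" where
  "kth_powers_in_AP k N q a =
     card {m \<in> (\<lambda>i. a + int i * int q) ` {1..N}. is_nth_power k m}"

definition Qmax :: "nat \<Rightarrow> nat \<Rightarrow> nat" where
  "Qmax k N = Max {kth_powers_in_AP k N q a | q a. q \<ge> 1 \<and> a \<ge> 0}"

lemma kth_powers_in_AP_le: "kth_powers_in_AP k N q a \<le> N"
proof -
  let ?S = "(\<lambda>i. a + int i * int q) ` {1..N}"
  have "kth_powers_in_AP k N q a \<le> card ?S"
    unfolding kth_powers_in_AP_def by (rule card_mono) auto
  also have "\<dots> \<le> N"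
    using card_image_le[of "{1..N}" "\<lambda>i. a + int i * int q"] by simp
  finally show ?thesis .
qed

text \<open>The set in \<open>Qmax\<close> is finite and nonempty, so its \<open>Max\<close> is a genuine maximum.\<close>

lemma finite_Qmax_set: "finite {kth_powers_in_AP k N q a | q a. q \<ge> 1 \<and> a \<ge> 0}"
  by (rule finite_subset[of _ "{..N}"]) (auto simp: kth_powers_in_AP_le)

lemma Qmax_set_nonempty: "{kth_powers_in_AP k N q a | q a. q \<ge> 1 \<and> a \<ge> 0} \<noteq> {}"
  by (auto intro: exI[of _ "1::nat"] exI[of _ "0::int"])

text \<open>
  \<open>log log N\<close> is undefined for \<open>N = 1\<close> and negative for \<open>N = 2\<close>, where a bound by
  \<open>exp (C * k * log N / log log N)\<close> is meaningless; for these two values the usual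
  convention that the iterated logarithm is read as 1 is used.
\<close>
definition loglog :: "nat \<Rightarrow> real" where
  "loglog N = (if N \<ge> 3 then ln (ln (real N)) else 1)"

end

theory Submission
  imports Defs "HOL-Number_Theory.Residue_Primitive_Roots"
begin

text \<open>
  Let \<open>S\<close> be the set of the bases \<open>x > 0\<close> with \<open>x\<^sup>k\<close> in the progression. Dividing \<open>S\<close> by its greatest
  common divisor (and \<open>q\<close> by the part it shares with the \<open>k\<close>-th power of that divisor) one may
  assume \<open>Gcd S = 1\<close>; then every \<open>x \<in> S\<close> is coprime to \<open>q\<close>, since a prime dividing \<open>q\<close> and one
  element of \<open>S\<close> divides all of them. If \<open>S\<close> has three elements, ABC with \<open>\<epsilon> = 1/6\<close>, applied to the
  linear relation between their \<open>k\<close>-th powers whose coefficients are at most \<open>N\<close>, bounds the powers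
  (after removing the common divisor of the three), and therefore \<open>q\<close>, by a fixed power of \<open>N\<close>;
  this needs \<open>k > 3\<close>. Finally the elements of \<open>S\<close> lie in at most \<open>(2k)\<^bsup>\<omega>(q)\<^esup>\<close> residue classes
  modulo \<open>q\<close> and in an interval of length \<open>(qN)\<^bsup>1/k\<^esup>\<close>, and \<open>\<omega>(q)\<close> is of order
  \<open>log N / log log N\<close>.
\<close>

subsection \<open>Roots of \<open>x\<^sup>k \<equiv> a\<close> modulo \<open>q\<close>\<close>

definition power_roots :: "nat \<Rightarrow> nat \<Rightarrow> nat \<Rightarrow> nat set" where
  "power_roots k n a = {x \<in> {..<n}. [x ^ k = a] (mod n)}"

lemma finite_power_roots [simp]: "finite (power_roots k n a)"
  by (simp add: power_roots_def)

lemma coprime_power_root: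
  assumes "x \<in> power_roots k n a" "coprime a n" "k > 0"
  shows "coprime x n"
proof -
  have "coprime (x ^ k) n"
    using assms cong_imp_coprime[of a "x ^ k" n] by (simp add: power_roots_def cong_sym)
  thus ?thesis using assms(3) by simp
qed

text \<open>With \<open>h = ord n g\<close>, two solutions \<open>i\<close>, \<open>j\<close>
  satisfy \<open>i * k = j * k\<close> modulo \<open>h\<close>, hence agree modulo
  \<open>t = h div gcd h k\<close>. Below \<open>h\<close> a single class modulo \<open>t\<close>
  has \<open>gcd h k\<close> members, which is at most \<open>k\<close>; the quotient
  \<open>i div t\<close> tells them apart.\<close>

lemma card_exponents_le:
  fixes n g c k :: nat
  assumes g: "coprime n g" and k: "k > 0"
  shows "card {i \<in> {..<ord n g}. [g ^ (i * k) = c] (mod n)} \<le> k"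
proof -
  define h where "h = ord n g"
  have h: "h > 0" using g by (simp add: h_def)
  define d where "d = gcd h k"
  define t where "t = h div d"
  have d: "d > 0" "d \<le> k" using k by (auto simp: d_def intro: dvd_imp_le)
  have ht: "h = t * d" by (simp add: t_def d_def)
  have t: "t > 0" using ht h by (cases t) auto
  have cop: "coprime t (k div d)"
    unfolding t_def d_def using h by (intro div_gcd_coprime) auto
  have kd: "k = (k div d) * d" by (simp add: d_def)
  have cong: "[i = j] (mod t)"
    if "[g ^ (i * k) = c] (mod n)" "[g ^ (j * k) = c] (mod n)" for i j
  proof -
    have "[g ^ (i * k) = g ^ (j * k)] (mod n)"
      using that cong_sym cong_trans by blast
    hence "[i * k = j * k] (mod h)"
      using g by (simp add: h_def order_divides_expdiff)
    hence "[(i * (k div d)) * d = (j * (k div d)) * d] (mod (t * d))"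
      using kd ht by (metis mult.assoc)
    hence "[i * (k div d) = j * (k div d)] (mod t)"
      using d by (simp add: cong_def mult_mod_left flip: mod_mult_mult2)
    thus ?thesis using cop by (simp add: cong_mult_rcancel coprime_commute cong_mult_rcancel_nat)
  qed
  let ?I = "{i \<in> {..<h}. [g ^ (i * k) = c] (mod n)}"
  have "card ?I \<le> card {..<d}"
  proof (rule card_inj_on_le)
    show "inj_on (\<lambda>i. i div t) ?I"
    proof (rule inj_onI)
      fix i j assume "i \<in> ?I" "j \<in> ?I" "i div t = j div t"
      moreover from this have "i mod t = j mod t"
        using cong[of i j] by (auto simp: cong_def)
      ultimately show "i = j" by (metis div_mult_mod_eq)
    qed
    show "(\<lambda>i. i div t) ` ?I \<subseteq> {..<d}"
      using t ht by (auto simp: less_mult_imp_div_less mult.commute)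
  qed simp
  thus ?thesis using d by (simp add: h_def)
qed

text \<open>Double counting of the map \<open>(x, i) \<mapsto> x g\<^sup>i\<close> from pairs of a root and an exponent to
  the unit group: a fibre is determined by \<open>i\<close>, and on it \<open>g ^ (i * k)\<close> is constant.\<close>

lemma card_power_roots_ord_le:
  fixes n g a k :: nat
  assumes n: "n > 1" and g: "coprime n g" and a: "coprime a n" and k: "k > 0"
  shows "card (power_roots k n a) * ord n g \<le> k * totient n"
proof -
  let ?A = "power_roots k n a" and ?h = "ord n g"
  define F where "F y = {xi \<in> ?A \<times> {..<?h}. (fst xi * g ^ snd xi) mod n = y}" for y
  have "?A \<times> {..<?h} \<subseteq> (\<Union>y\<in>totatives n. F y)"
  proof
    fix xi assume xi: "xi \<in> ?A \<times> {..<?h}"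
    hence "coprime (fst xi) n" using coprime_power_root a k by auto
    hence "coprime (fst xi * g ^ snd xi) n" using g by (simp add: coprime_commute)
    hence cop: "coprime ((fst xi * g ^ snd xi) mod n) n"
      by (metis coprime_mod_left_iff n not_one_less_zero)
    hence "(fst xi * g ^ snd xi) mod n > 0"
      using n by (intro gr0I) simp
    with cop n have "(fst xi * g ^ snd xi) mod n \<in> totatives n"
      by (auto simp: totatives_def less_imp_le)
    thus "xi \<in> (\<Union>y\<in>totatives n. F y)" using xi by (auto simp: F_def)
  qed
  hence "card (?A \<times> {..<?h}) \<le> card (\<Union>y\<in>totatives n. F y)"
    by (intro card_mono finite_UN_I) (auto simp: F_def)
  also have "\<dots> \<le> (\<Sum>y\<in>totatives n. card (F y))"
    by (intro card_UN_le) auto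
  also have "\<dots> \<le> (\<Sum>y\<in>totatives n. k)"
  proof (intro sum_mono)
    fix y assume "y \<in> totatives n"
    \<comment> \<open>With \<open>b\<close> inverse to \<open>a\<close>, raising
      \<open>x * g ^ i = y\<close> to the power \<open>k\<close> gives
      \<open>a * g ^ (i * k) = y ^ k\<close>. So the exponents in the fibre over \<open>y\<close>
      all solve one equation with right side \<open>b * y ^ k\<close>.\<close>
    obtain b where b: "[a * b = 1] (mod n)"
      using cong_solve_coprime_nat[OF a] by auto
    have "card (F y) \<le> card {i \<in> {..<?h}. [g ^ (i * k) = b * y ^ k] (mod n)}"
    proof (rule card_inj_on_le)
      show "inj_on snd (F y)"
      proof (rule inj_onI)
        fix u v assume u: "u \<in> F y" and v: "v \<in> F y" and uv: "snd u = snd v"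
        hence "[fst u * g ^ snd u = fst v * g ^ snd u] (mod n)"
          by (auto simp: F_def cong_def)
        hence "[fst u = fst v] (mod n)" using g by (simp add: cong_mult_rcancel_nat coprime_commute)
        moreover have "fst u < n" "fst v < n" using u v by (auto simp: F_def power_roots_def)
        ultimately have "fst u = fst v" by (simp add: cong_def)
        thus "u = v" using uv by (simp add: prod_eq_iff)
      qed
      show "snd ` F y \<subseteq> {i \<in> {..<?h}. [g ^ (i * k) = b * y ^ k] (mod n)}"
      proof safe
        fix u1 u2 assume u: "(u1, u2) \<in> F y"
        hence ua: "[u1 ^ k = a] (mod n)" by (auto simp: F_def power_roots_def)
        have "[u1 * g ^ u2 = y] (mod n)" using u by (auto simp: F_def cong_def)
        hence "[(u1 * g ^ u2) ^ k = y ^ k] (mod n)" by (rule cong_pow)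
        hence "[u1 ^ k * g ^ (u2 * k) = y ^ k] (mod n)"
          by (simp add: power_mult_distrib power_mult)
        hence "[b * (u1 ^ k * g ^ (u2 * k)) = b * y ^ k] (mod n)"
          by (intro cong_mult cong_refl)
        moreover have "[b * (u1 ^ k * g ^ (u2 * k)) = b * (a * g ^ (u2 * k))] (mod n)"
          using ua by (intro cong_mult cong_refl)
        moreover have "[b * (a * g ^ (u2 * k)) = 1 * g ^ (u2 * k)] (mod n)"
          using cong_mult[OF b cong_refl[of "g ^ (u2 * k)"]] by (simp add: mult_ac)
        ultimately show "[g ^ (snd (u1, u2) * k) = b * y ^ k] (mod n)"
          by (simp add: cong_def)
      qed (auto simp: F_def)
    qed simp
    also have "\<dots> \<le> k" by (rule card_exponents_le[OF g k])
    finally show "card (F y) \<le> k" .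
  qed
  also have "\<dots> = k * totient n" by (simp add: totient_def)
  finally show ?thesis by (simp add: card_cartesian_product)
qed

text \<open>The double count loses the index of the subgroup generated by \<open>g\<close>. For odd
  \<open>p\<close> a primitive root has index 1. For \<open>2 ^ e\<close> with
  \<open>e \<ge> 3\<close> the unit group is not cyclic, but 5 generates a subgroup of index 2,
  whence the factor 2. The moduli 2 and 4 have at most two units.\<close>

lemma card_power_roots_prime_power_le:
  fixes p e a k :: nat
  assumes p: "prime p" and e: "e > 0" and a: "coprime a (p ^ e)" and k: "k > 0"
  shows "card (power_roots k (p ^ e) a) \<le> 2 * k"
proof -
  have n1: "p ^ e > 1" using p e one_less_power prime_gt_1_nat by blast
  consider "odd p" | "p = 2" "e \<ge> 3" | "p = 2" "e \<le> 2"
    using prime_odd_nat[OF p] prime_ge_2_nat[OF p] by (cases "p = 2"; cases "e \<le> 2") auto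
  thus ?thesis
  proof cases
    case 1
    then obtain g where "residue_primroot (p ^ e) g"
      using residue_primroot_odd_prime_power_exists[OF p] e by blast
    hence "coprime (p ^ e) g" "ord (p ^ e) g = totient (p ^ e)"
      by (auto simp: residue_primroot_def)
    with card_power_roots_ord_le[OF n1 this(1) a k] have "card (power_roots k (p ^ e) a) \<le> k"
      using n1 by (metis mult_le_cancel2 totient_gt_0_iff zero_less_one order_less_trans)
    thus ?thesis by simp
  next
    case 2
    have "coprime (p ^ e) (5::nat)" using 2 by simp
    moreover have "ord (p ^ e) 5 = 2 ^ (e - 2)" using ord_twopow_3_5[of e 5] 2 by simp
    moreover have "totient (p ^ e) = 2 * 2 ^ (e - 2)"
    proof -
      have "totient (p ^ e) = 2 ^ (e - 1)" using 2 by (simp add: totient_prime_power)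
      also have "e - 1 = Suc (e - 2)" using 2 by simp
      finally show ?thesis by simp
    qed
    ultimately show ?thesis using card_power_roots_ord_le[OF n1 _ a k, of 5] by simp
  next
    case 3
    have "power_roots k (p ^ e) a \<subseteq> totatives (p ^ e)"
    proof
      fix x assume x: "x \<in> power_roots k (p ^ e) a"
      hence "coprime x (p ^ e)" using a k coprime_power_root by blast
      moreover from this have "x > 0" using n1 by (cases x) auto
      ultimately show "x \<in> totatives (p ^ e)" using x by (auto simp: totatives_def power_roots_def)
    qed
    hence "card (power_roots k (p ^ e) a) \<le> totient (p ^ e)"
      unfolding totient_def by (intro card_mono) auto
    also have "\<dots> = 2 ^ (e - 1)" using 3 e by (simp add: totient_prime_power)
    also have "\<dots> \<le> 2 ^ 1" using 3 by (intro power_increasing) auto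
    finally show ?thesis using k by simp
  qed
qed

text \<open>Injectivity in the Chinese remainder theorem: a root modulo \<open>m * n\<close> is
  determined by its two reductions, which are again roots.\<close>

lemma card_power_roots_mult_le:
  fixes m n a k :: nat
  assumes "coprime m n" "m > 0" "n > 0"
  shows "card (power_roots k (m * n) a) \<le> card (power_roots k m a) * card (power_roots k n a)"
proof -
  let ?f = "\<lambda>x. (x mod m, x mod n)"
  have "card (power_roots k (m * n) a) \<le> card (power_roots k m a \<times> power_roots k n a)"
  proof (rule card_inj_on_le)
    show "inj_on ?f (power_roots k (m * n) a)"
    proof (rule inj_onI)
      fix x y assume "x \<in> power_roots k (m * n) a" "y \<in> power_roots k (m * n) a" "?f x = ?f y"
      moreover from this have "[x = y] (mod (m * n))"
        by (intro coprime_cong_mult_nat[OF _ _ assms(1)]) (simp_all add: cong_def)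
      ultimately show "x = y" by (auto simp: power_roots_def cong_def)
    qed
    show "?f ` power_roots k (m * n) a \<subseteq> power_roots k m a \<times> power_roots k n a"
    proof
      fix z assume "z \<in> ?f ` power_roots k (m * n) a"
      then obtain x where x: "z = ?f x" "[x ^ k = a] (mod (m * n))"
        by (auto simp: power_roots_def)
      hence "[x ^ k = a] (mod m)" "[x ^ k = a] (mod n)"
        using cong_modulus_mult_nat[of "x ^ k" a m n] cong_modulus_mult_nat[of "x ^ k" a n m]
        by (simp_all add: mult.commute)
      thus "z \<in> power_roots k m a \<times> power_roots k n a"
        using assms x by (simp add: power_roots_def cong_def power_mod)
    qed
  qed simp
  thus ?thesis by (simp add: card_cartesian_product)
qed

lemma card_power_roots_le:
  fixes q a k :: nat
  assumes "q > 0" "coprime a q" "k > 0"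
  shows "card (power_roots k q a) \<le> (2 * k) ^ card (prime_factors q)"
  using assms
proof (induction q rule: less_induct)
  case (less q)
  show ?case
  proof (cases "q = 1")
    case True
    have "power_roots k q a \<subseteq> {0}" using True by (auto simp: power_roots_def)
    hence "card (power_roots k q a) \<le> card {0::nat}" by (rule card_mono[rotated]) simp
    thus ?thesis using True by simp
  next
    case False
    then obtain p where p: "prime p" "p dvd q" using prime_factor_nat by blast
    \<comment> \<open>Splitting off the full power of \<open>p\<close> makes the cofactor coprime to
      it and lowers the number of prime factors by exactly one, at the cost of one factor
      \<open>2 * k\<close>.\<close>
    define e where "e = multiplicity p q"
    have e: "e > 0" using p less.prems by (simp add: e_def prime_multiplicity_gt_zero_iff)
    obtain m where m: "q = p ^ e * m" "\<not> p dvd m"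
      using multiplicity_decompose'[of q p] p less.prems unfolding e_def
      by (metis not_prime_unit less_numeral_extra(3))
    have m0: "m > 0" using m less.prems by (cases m) auto
    have cop: "coprime (p ^ e) m" using m p by (simp add: prime_imp_coprime)
    have pe: "p ^ e > 1" using p e one_less_power prime_gt_1_nat by blast
    have "m < q" using m m0 pe by simp
    have "prime_factors q = insert p (prime_factors m)"
      using m m0 p e by (auto simp: prime_factorization_mult prime_factorization_prime_power
          prime_factors_multiplicity)
    moreover have "p \<notin> prime_factors m" using m by auto
    ultimately have card: "card (prime_factors q) = Suc (card (prime_factors m))" by simp
    have ca: "coprime a (p ^ e)" "coprime a m" using less.prems m by auto
    have "card (power_roots k q a) \<le> card (power_roots k (p ^ e) a) * card (power_roots k m a)"
      unfolding m using cop m0 pe by (intro card_power_roots_mult_le)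
        (auto intro: prime_gt_0_nat[OF p(1)])
    also have "\<dots> \<le> (2 * k) * (2 * k) ^ card (prime_factors m)"
      using card_power_roots_prime_power_le[OF p(1) e ca(1)] less.IH[OF \<open>m < q\<close> m0 ca(2)] less.prems
      by (intro mult_mono) auto
    finally show ?thesis by (simp add: card)
  qed
qed

subsection \<open>The number of prime factors\<close>

text \<open>The primes are split at the free threshold \<open>T\<close>. At most \<open>T\<close> of
  them are small, and the large ones have product at most \<open>q\<close>, so their number is at
  most the logarithm of \<open>q\<close> to base \<open>T\<close>.\<close>

lemma card_prime_factors_le:
  fixes q :: nat and T :: real
  assumes q: "q > 0" and T: "T > 1"
  shows "real (card (prime_factors q)) \<le> T + ln (real q) / ln T"
proof -
  define small where "small = {p \<in> prime_factors q. real p \<le> T}"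
  define big where "big = {p \<in> prime_factors q. real p > T}"
  have "card (prime_factors q) = card small + card big"
    unfolding small_def big_def by (subst card_Un_disjoint[symmetric])
      (auto intro!: arg_cong[where f = card])
  moreover have "real (card small) \<le> T"
  proof -
    have "small \<subseteq> {1..nat \<lfloor>T\<rfloor>}"
      by (auto simp: small_def le_nat_floor dest!: in_prime_factors_imp_prime prime_ge_1_nat)
    hence "card small \<le> card {1..nat \<lfloor>T\<rfloor>}" by (intro card_mono) auto
    hence "card small \<le> nat \<lfloor>T\<rfloor>" by simp
    also have "real (nat \<lfloor>T\<rfloor>) \<le> T" using T by simp
    finally show ?thesis by simp
  qed
  moreover have "real (card big) \<le> ln (real q) / ln T"
  proof -
    have "T ^ card big = (\<Prod>p\<in>big. T)" by simp
    also have "\<dots> \<le> (\<Prod>p\<in>big. real p)"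
      using T by (intro prod_mono) (auto simp: big_def)
    also have "\<dots> \<le> (\<Prod>p\<in>prime_factors q. real p)"
      by (intro prod_mono2) (auto simp: big_def dest!: in_prime_factors_imp_prime prime_ge_1_nat)
    also have "\<dots> \<le> (\<Prod>p\<in>prime_factors q. real p ^ multiplicity p q)"
    proof (intro prod_mono conjI)
      fix p assume p: "p \<in> prime_factors q"
      hence "multiplicity p q > 0" by (simp add: prime_factors_multiplicity)
      moreover have "real p \<ge> 1" using p prime_ge_1_nat[of p] by auto
      ultimately show "real p \<le> real p ^ multiplicity p q" by (intro self_le_power) auto
    qed auto
    also have "\<dots> = real (\<Prod>p\<in>prime_factors q. p ^ multiplicity p q)" by simp
    also have "(\<Prod>p\<in>prime_factors q. p ^ multiplicity p q) = q"
      using prod_prime_factors[of q] q by simp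
    finally have "ln (T ^ card big) \<le> ln (real q)" using T q by (subst ln_le_cancel_iff) auto
    thus ?thesis using T by (simp add: ln_realpow field_simps)
  qed
  ultimately show ?thesis by simp
qed

text \<open>The threshold is \<open>sqrt L\<close>: its logarithm is still \<open>ln L / 2\<close>,
  while \<open>sqrt L\<close> itself is absorbed in \<open>2 * (L / ln L)\<close>.\<close>

lemma card_prime_factors_le_ln:
  fixes q :: nat and L c :: real
  assumes q: "q > 0" "ln (real q) \<le> c * L" and L: "L > 1"
  shows "real (card (prime_factors q)) \<le> (2 + 2 * c) * (L / ln L)"
proof -
  have lnL: "ln L > 0" and sqrtL: "sqrt L > 1" using L by simp_all
  have ln_sqrt: "ln (sqrt L) = ln L / 2" using L by (simp add: ln_sqrt)
  have "real (card (prime_factors q)) \<le> sqrt L + ln (real q) / (ln L / 2)"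
    using card_prime_factors_le[OF q(1) sqrtL] by (simp add: ln_sqrt)
  also have "ln (real q) / (ln L / 2) \<le> c * L / (ln L / 2)"
    using q lnL by (intro divide_right_mono) auto
  also have "sqrt L \<le> 2 * (L / ln L)"
  proof -
    have "ln L / 2 \<le> sqrt L" using ln_le_minus_one[of "sqrt L"] sqrtL ln_sqrt by simp
    hence "sqrt L * (ln L / 2) \<le> sqrt L * sqrt L" using sqrtL by (intro mult_left_mono) auto
    also have "\<dots> = L" using L by simp
    finally show ?thesis using lnL by (simp add: field_simps)
  qed
  finally show ?thesis by (simp add: algebra_simps)
qed

subsection \<open>ABC for three powers\<close>

text \<open>Fixing both \<open>\<epsilon>\<close> and \<open>K\<close> lets one constant run through
  the whole argument, so that the final \<open>C\<close> depends on neither \<open>k\<close> nor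
  \<open>N\<close>.\<close>

definition abc_bound :: "real \<Rightarrow> real \<Rightarrow> bool" where
  "abc_bound \<epsilon> K \<longleftrightarrow> (\<forall>a b c :: int.
     a \<noteq> 0 \<longrightarrow> b \<noteq> 0 \<longrightarrow> c \<noteq> 0 \<longrightarrow> Gcd {a, b, c} = 1 \<longrightarrow> a + b = c \<longrightarrow>
       real_of_int (Max {\<bar>a\<bar>, \<bar>b\<bar>, \<bar>c\<bar>}) \<le> K * real_of_int (rad (a * b * c)) powr (1 + \<epsilon>))"

lemma abc_conjecture_iff: "abc_conjecture \<longleftrightarrow> (\<forall>\<epsilon>>0. \<exists>K. abc_bound \<epsilon> K)"
  by (simp only: abc_conjecture_def abc_bound_def)

text \<open>Allows the ABC constant to be enlarged to at least 1, so that \<open>ln K\<close> is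
  nonnegative later.\<close>

lemma abc_bound_mono:
  assumes "abc_bound \<epsilon> K" "K \<le> K'"
  shows "abc_bound \<epsilon> K'"
  unfolding abc_bound_def
proof (intro allI impI)
  fix a b c :: int
  assume "a \<noteq> 0" "b \<noteq> 0" "c \<noteq> 0" "Gcd {a, b, c} = 1" "a + b = c"
  hence "real_of_int (Max {\<bar>a\<bar>, \<bar>b\<bar>, \<bar>c\<bar>}) \<le> K * real_of_int (rad (a * b * c)) powr (1 + \<epsilon>)"
    using assms(1) unfolding abc_bound_def by blast
  also have "\<dots> \<le> K' * real_of_int (rad (a * b * c)) powr (1 + \<epsilon>)"
    using assms(2) by (intro mult_right_mono) auto
  finally show "real_of_int (Max {\<bar>a\<bar>, \<bar>b\<bar>, \<bar>c\<bar>}) \<le> K' * real_of_int (rad (a * b * c)) powr (1 + \<epsilon>)" .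
qed

text \<open>Only the primes dividing \<open>n\<close> matter, not their exponents. In the
  application \<open>n\<close> contains \<open>k\<close>-th powers, and \<open>w\<close> contains
  just their bases.\<close>

lemma rad_le:
  fixes n w :: int
  assumes "w \<noteq> 0" and dvd: "\<And>p. prime p \<Longrightarrow> p dvd n \<Longrightarrow> p dvd w"
  shows "rad n \<le> \<bar>w\<bar>"
proof -
  have pos: "p \<ge> 1" if "p \<in> prime_factors m" for p m :: int
    using that prime_ge_1_int[of p] by auto
  have sub: "prime_factors n \<subseteq> prime_factors w"
    using assms by (auto simp: prime_factors_dvd in_prime_factors_iff)
  have "rad n \<le> (\<Prod>p\<in>prime_factors w. p)"
    unfolding rad_def using sub pos by (intro prod_mono2) (auto simp: order_trans[OF zero_le_one])
  also have "\<dots> \<le> (\<Prod>p\<in>prime_factors w. p ^ multiplicity p w)"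
  proof (intro prod_mono conjI)
    fix p assume p: "p \<in> prime_factors w"
    hence "multiplicity p w > 0" by (simp add: prime_factors_multiplicity)
    thus "p \<le> p ^ multiplicity p w" using pos[OF p] by (intro self_le_power) auto
    show "0 \<le> p" using pos[OF p] by simp
  qed
  also have "\<dots> = \<bar>w\<bar>" using prod_prime_factors[OF assms(1)] by simp
  finally show ?thesis .
qed

lemma rad_nonneg: "rad n \<ge> 0"
  unfolding rad_def by (intro prod_nonneg) (auto dest: prime_ge_0_int)

text \<open>The three powers are eliminated from the progression by
  \<open>x\<^sup>k (y\<^sup>k - z\<^sup>k) + y\<^sup>k (z\<^sup>k - x\<^sup>k) + z\<^sup>k (x\<^sup>k - y\<^sup>k) = 0\<close>; dividing by \<open>q\<close> leaves an ABC triple in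
  which \<open>q\<close> no longer occurs.\<close>

lemma abc_three_powers:
  fixes x y z k q N :: nat and m1 m2 m3 :: int and K :: real
  assumes abc: "abc_bound (1 / 6) K"
    and K: "K \<ge> 1" and k: "k \<ge> 4" and q: "q > 0" and N: "N > 0"
    and pos: "x > 0" "y > 0" "z > 0" and neq: "x \<noteq> y" "y \<noteq> z" "z \<noteq> x"
    and gcd1: "gcd x (gcd y z) = 1"
    and m1: "int x ^ k - int y ^ k = int q * m1" "\<bar>m1\<bar> \<le> int N"
    and m2: "int y ^ k - int z ^ k = int q * m2" "\<bar>m2\<bar> \<le> int N"
    and m3: "int z ^ k - int x ^ k = int q * m3" "\<bar>m3\<bar> \<le> int N"
  shows "real q \<le> K ^ 8 * real N ^ 52"
proof -
  have k0: "k > 0" using k by simp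
  have ne: "m1 \<noteq> 0" "m2 \<noteq> 0" "m3 \<noteq> 0"
    using m1(1) m2(1) m3(1) neq k0 by (auto simp: power_eq_iff_eq_base simp flip: of_nat_power)
  define A where "A = int x ^ k * m2"
  define B where "B = int y ^ k * m3"
  define D where "D = int z ^ k * m1"
  define P where "P = m1 * m2 * m3"
  have ABD_ne: "A \<noteq> 0" "B \<noteq> 0" "D \<noteq> 0" using ne pos by (auto simp: A_def B_def D_def)
  have "int q * (A + B + D) = 0"
  proof -
    have "int q * (A + B + D) =
        int x ^ k * (int q * m2) + int y ^ k * (int q * m3) + int z ^ k * (int q * m1)"
      by (simp add: A_def B_def D_def algebra_simps)
    also have "\<dots> = 0" unfolding m1(1)[symmetric] m2(1)[symmetric] m3(1)[symmetric]
      by (simp add: algebra_simps)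
    finally show ?thesis .
  qed
  hence sum0: "A + B + D = 0" using q by simp
  define g where "g = gcd A (gcd B D)"
  have g0: "g > 0" using ABD_ne by (simp add: g_def)
  have gdvd: "g dvd A" "g dvd B" "g dvd D" by (auto simp: g_def intro: dvd_trans)
  \<comment> \<open>Each of \<open>m1\<close>, \<open>m2\<close>, \<open>m3\<close> divides
    \<open>P\<close>, so \<open>g\<close> divides \<open>P\<close> times each of the three powers.
    The powers have greatest common divisor 1, hence \<open>g\<close> divides \<open>P\<close> and
    making the triple primitive costs at most \<open>N ^ 3\<close>.\<close>
  have "g dvd P"
  proof -
    have "A dvd int x ^ k * \<bar>P\<bar>" "B dvd int y ^ k * \<bar>P\<bar>" "D dvd int z ^ k * \<bar>P\<bar>"
      unfolding A_def B_def D_def by (intro mult_dvd_mono; simp add: P_def)+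
    hence "g dvd gcd (int x ^ k * \<bar>P\<bar>) (gcd (int y ^ k * \<bar>P\<bar>) (int z ^ k * \<bar>P\<bar>))"
      using gdvd by (meson dvd_trans gcd_greatest)
    also have "\<dots> = gcd (int x ^ k) (gcd (int y ^ k) (int z ^ k)) * \<bar>P\<bar>"
      by (simp add: gcd_mult_right gcd.commute gcd.left_commute)
    also have "gcd (int x ^ k) (gcd (int y ^ k) (int z ^ k)) = 1"
    proof -
      have "gcd (int x) (gcd (int y) (int z)) = 1"
        using gcd1 by (metis gcd_int_int_eq of_nat_1)
      thus ?thesis using k0 by (simp add: gcd_exp)
    qed
    finally show ?thesis by simp
  qed
  have Pne: "P \<noteq> 0" using ne by (simp add: P_def)
  have PN: "\<bar>P\<bar> \<le> int N ^ 3"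
  proof -
    have "\<bar>P\<bar> = \<bar>m1\<bar> * \<bar>m2\<bar> * \<bar>m3\<bar>" by (simp add: P_def abs_mult)
    also have "\<dots> \<le> int N * int N * int N" using m1 m2 m3 by (intro mult_mono) auto
    finally show ?thesis by (simp add: power3_eq_cube)
  qed
  have gN: "g \<le> int N ^ 3"
    using \<open>g dvd P\<close> Pne PN dvd_imp_le_int[of P g] g0 by simp
  define X where "X = max x (max y z)"
  have X: "X > 1" "x \<le> X" "y \<le> X" "z \<le> X" using pos neq by (auto simp: X_def)
  define a b c where "a = A div g" and "b = B div g" and "c = - (D div g)"
  have abcA: "A = g * a" "B = g * b" "D = - (g * c)"
    using gdvd by (simp_all add: a_def b_def c_def)
  have ne': "a \<noteq> 0" "b \<noteq> 0" "c \<noteq> 0" using abcA ABD_ne by auto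
  have "g * (a + b) = g * c" using sum0 abcA by (simp add: algebra_simps)
  hence ab: "a + b = c" using g0 by simp
  have "g * gcd a (gcd b c) = g * 1"
  proof -
    have "g = gcd (g * a) (gcd (g * b) (g * c))" using g_def abcA by simp
    also have "\<dots> = g * gcd a (gcd b c)" using g0 by (simp add: gcd_mult_left)
    finally show ?thesis by simp
  qed
  hence gcdabc: "Gcd {a, b, c} = 1" using g0 by simp
  define R where "R = rad (a * b * c)"
  have "R \<le> \<bar>int x * int y * int z * P\<bar>"
    unfolding R_def
  proof (rule rad_le)
    show "int x * int y * int z * P \<noteq> 0" using pos Pne by simp
    fix p :: int assume p: "prime p" "p dvd a * b * c"
    have "a * b * c dvd A * B * D" using abcA by (simp add: mult_dvd_mono)
    hence "p dvd A * B * D" using p dvd_trans by blast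
    thus "p dvd int x * int y * int z * P"
      using p(1) by (auto simp: A_def B_def D_def P_def prime_dvd_mult_iff dest: prime_dvd_power)
  qed
  also have "\<dots> = int x * int y * int z * \<bar>P\<bar>" by (simp add: abs_mult)
  also have "\<dots> \<le> int X * int X * int X * int N ^ 3"
    using X PN by (intro mult_mono) auto
  finally have R: "R \<le> int X ^ 3 * int N ^ 3" by (simp add: power3_eq_cube)
  define M where "M = Max {\<bar>a\<bar>, \<bar>b\<bar>, \<bar>c\<bar>}"
  \<comment> \<open>The power of the largest base occurs in one of \<open>A\<close>,
    \<open>B\<close>, \<open>D\<close> with a nonzero integer coefficient, so it is at most the
    absolute value of that term.\<close>
  have "int X ^ k \<le> g * M"
  proof -
    have "int u ^ k \<le> g * M" if "\<bar>int u ^ k * m\<bar> = g * \<bar>v\<bar>" "m \<noteq> 0" "v \<in> {a, b, c}"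
      for u m v
    proof -
      have "int u ^ k * 1 \<le> int u ^ k * \<bar>m\<bar>" using that by (intro mult_left_mono) auto
      also have "\<dots> = \<bar>int u ^ k * m\<bar>" by (simp add: abs_mult)
      also have "\<dots> = g * \<bar>v\<bar>" by (rule that)
      also have "\<dots> \<le> g * M" using that g0 by (intro mult_left_mono) (auto simp: M_def le_max_iff_disj)
      finally show ?thesis by simp
    qed
    moreover have "\<bar>A\<bar> = g * \<bar>a\<bar>" "\<bar>B\<bar> = g * \<bar>b\<bar>" "\<bar>D\<bar> = g * \<bar>c\<bar>"
      unfolding abcA using g0 by (simp_all add: abs_mult)
    ultimately have "int x ^ k \<le> g * M" "int y ^ k \<le> g * M" "int z ^ k \<le> g * M"
      using ne unfolding A_def B_def D_def by blast+
    thus ?thesis by (auto simp: X_def max_def)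
  qed
  also have "\<dots> \<le> int N ^ 3 * M" using gN by (intro mult_right_mono) (auto simp: M_def)
  finally have "real_of_int (int X ^ k) \<le> real_of_int (int N ^ 3 * M)" by linarith
  hence XM: "real X ^ k \<le> real N ^ 3 * real_of_int M" by simp
  define Y where "Y = real X ^ k"
  have Y1: "Y \<ge> 1" using X by (simp add: Y_def)
  have "real_of_int M \<le> K * real_of_int R powr (1 + 1 / 6)"
    unfolding M_def R_def 
    using abc[unfolded abc_bound_def] ne' gcdabc ab by blast
  also have "\<dots> \<le> K * (real X ^ 3 * real N ^ 3) powr (1 + 1 / 6)"
  proof (intro mult_left_mono powr_mono2)
    show "real_of_int R \<le> real X ^ 3 * real N ^ 3"
    proof -
      have "real_of_int R \<le> real_of_int (int X ^ 3 * int N ^ 3)" using R by (simp only: of_int_le_iff)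
      thus ?thesis by simp
    qed
  qed (use K in \<open>auto simp: R_def rad_nonneg\<close>)
  also have "(real X ^ 3 * real N ^ 3) powr (1 + 1 / 6) = real X powr (7 / 2) * real N powr (7 / 2)"
  proof -
    have "(real u ^ 3) powr (1 + 1 / 6) = real u powr (7 / 2)" if "u > 0" for u :: nat
      using that powr_powr[of "real u" 3 "7 / 6"] by (simp add: powr_numeral)
    thus ?thesis using X N by (simp add: powr_mult)
  qed
  \<comment> \<open>The radical contributes \<open>X\<close> to the power
    \<open>3 * (7 / 6) = 7 / 2\<close>, which is exactly 7/8 of 4. Thus \<open>k \<ge> 4\<close>
    keeps this below \<open>Y powr (7 / 8)\<close> and leaves an eighth of the exponent to
    gain.\<close>
  also have "real X powr (7 / 2) \<le> real X powr (real k * (7 / 8))"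
    using X k by (intro powr_mono) auto
  also have "\<dots> = Y powr (7 / 8)"
    using X powr_powr[of "real X" "real k" "7 / 8"] by (simp add: Y_def powr_realpow)
  finally have M: "real_of_int M \<le> K * (Y powr (7 / 8) * real N powr (7 / 2))"
    using K by (simp add: mult_left_mono mult_right_mono)
  \<comment> \<open>Cancelling \<open>Y powr (7 / 8)\<close> leaves \<open>Y powr (1 / 8)\<close>
    bounded by \<open>K\<close> times \<open>N\<close> to the power
    \<open>3 + 7 / 2 = 13 / 2\<close>; the eighth power gives the exponents 8 and 52.\<close>
  have "Y powr (1 / 8) * Y powr (7 / 8) = Y" using Y1 by (simp flip: powr_add)
  also have "Y \<le> real N ^ 3 * real_of_int M" using XM by (simp add: Y_def)
  also have "\<dots> \<le> real N ^ 3 * (K * (Y powr (7 / 8) * real N powr (7 / 2)))"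
    using M by (intro mult_left_mono) auto
  also have "\<dots> = K * (real N powr 3 * real N powr (7 / 2)) * Y powr (7 / 8)"
    using N by (simp add: powr_numeral)
  also have "real N powr 3 * real N powr (7 / 2) = real N powr (13 / 2)"
    using powr_add[of "real N" 3 "7 / 2"] by simp
  finally have "Y powr (1 / 8) \<le> K * real N powr (13 / 2)"
    using Y1 by simp
  hence "(Y powr (1 / 8)) ^ 8 \<le> (K * real N powr (13 / 2)) ^ 8"
    by (intro power_mono) auto
  also have "(Y powr (1 / 8)) ^ 8 = Y" using Y1 powr_powr[of Y "1 / 8" 8] by (simp add: powr_numeral)
  also have "(K * real N powr (13 / 2)) ^ 8 = K ^ 8 * (real N powr (13 / 2)) powr 8"
    using N by (simp add: power_mult_distrib powr_numeral)
  also have "(real N powr (13 / 2)) powr 8 = real N ^ 52"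
    using N by (simp add: powr_powr powr_numeral)
  finally have Yb: "Y \<le> K ^ 8 * real N ^ 52" .
  \<comment> \<open>\<open>q\<close> divides the nonzero difference of two nonnegative powers, each
    at most \<open>X ^ k\<close>.\<close>
  have "int q \<le> int X ^ k"
  proof -
    have "int q * 1 \<le> int q * \<bar>m1\<bar>" using ne by (intro mult_left_mono) auto
    also have "\<dots> = \<bar>int x ^ k - int y ^ k\<bar>" using m1 by (simp add: abs_mult)
    also have "\<dots> \<le> max (int x ^ k) (int y ^ k)"
      using zero_le_power[of "int x" k] zero_le_power[of "int y" k] by linarith
    also have "\<dots> \<le> int X ^ k" using X by (auto intro: power_mono)
    finally show ?thesis by simp
  qed
  hence "real q \<le> Y" unfolding Y_def by (simp flip: of_nat_power)
  thus ?thesis using Yb by simp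
qed

subsection \<open>Powers with bounded differences modulo \<open>q\<close>\<close>

text \<open>The base point \<open>a\<close> of the progression is irrelevant: only the differences of the powers matter,
  and this form is preserved when the bases are divided by a common divisor.\<close>

definition power_cluster :: "nat \<Rightarrow> nat \<Rightarrow> nat \<Rightarrow> nat set \<Rightarrow> bool" where
  "power_cluster k q N S \<longleftrightarrow> finite S \<and> (\<forall>x\<in>S. x > 0) \<and>
     (\<forall>x\<in>S. \<forall>y\<in>S. \<exists>m. \<bar>m\<bar> \<le> int N \<and> int x ^ k - int y ^ k = int q * m)"

lemma power_cluster_subset:
  "power_cluster k q N S \<Longrightarrow> S' \<subseteq> S \<Longrightarrow> power_cluster k q N S'"
  unfolding power_cluster_def by (meson finite_subset subsetD)

lemma power_clusterE:
  assumes "power_cluster k q N S" "x \<in> S" "y \<in> S"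
  obtains m where "\<bar>m\<bar> \<le> int N" "int x ^ k - int y ^ k = int q * m"
  using assms that unfolding power_cluster_def by meson

text \<open>Cancelling \<open>gcd q (d ^ k)\<close> leaves \<open>e * u = q' * m\<close> with
  \<open>e\<close> coprime to \<open>q'\<close>. Hence \<open>e\<close> divides \<open>m\<close>,
  and the new multiplier \<open>m div e\<close> is no larger than \<open>m\<close>, so the same
  \<open>N\<close> serves.\<close>

lemma power_cluster_div:
  assumes cl: "power_cluster k q N S" and q: "q > 0" and d: "d > 0"
    and dvd: "\<And>x. x \<in> S \<Longrightarrow> d dvd x"
  shows "power_cluster k (q div gcd q (d ^ k)) N ((\<lambda>x. x div d) ` S)"
proof -
  define g where "g = gcd q (d ^ k)"
  define q' where "q' = q div g"
  define e where "e = d ^ k div g"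
  have g: "g > 0" using q by (simp add: g_def)
  have qg: "q = g * q'" and eg: "d ^ k = g * e" by (simp_all add: g_def q'_def e_def)
  have e: "e > 0" using eg d by (cases e) auto
  have cop: "coprime q' e" unfolding q'_def e_def g_def
    using q by (intro div_gcd_coprime) auto
  have "\<exists>m'. \<bar>m'\<bar> \<le> int N \<and> int (x div d) ^ k - int (y div d) ^ k = int q' * m'"
    if xyS: "x \<in> S" "y \<in> S" for x y
  proof -
    obtain m where m: "\<bar>m\<bar> \<le> int N" "int x ^ k - int y ^ k = int q * m"
      using power_clusterE[OF cl xyS] .
    define u where "u = int (x div d) ^ k - int (y div d) ^ k"
    have "x = d * (x div d)" "y = d * (y div d)" using dvd that by simp_all
    hence xy: "int x ^ k = int (d ^ k) * int (x div d) ^ k"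
        "int y ^ k = int (d ^ k) * int (y div d) ^ k"
      by (metis of_nat_mult of_nat_power power_mult_distrib)+
    have "int g * (int e * u) = int g * (int q' * m)"
      using m(2) unfolding xy u_def eg qg by (simp add: algebra_simps)
    hence eq: "int e * u = int q' * m" using g by simp
    hence "int e dvd int q' * m" by (metis dvd_triv_left)
    moreover have "coprime (int e) (int q')" using cop by (simp add: coprime_commute)
    ultimately have "int e dvd m" by (simp add: coprime_dvd_mult_right_iff)
    then obtain m' where m': "m = int e * m'" by (elim dvdE)
    have "int e * u = int e * (int q' * m')" using eq m' by simp
    hence "u = int q' * m'" using e by simp
    moreover have "\<bar>m'\<bar> \<le> \<bar>m\<bar>"
      using e mult_right_mono[of 1 "int e" "\<bar>m'\<bar>"] by (simp add: m' abs_mult)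
    ultimately show ?thesis using m(1) unfolding u_def by (intro exI[of _ m']) simp
  qed
  moreover have "x div d > 0" if "x \<in> S" for x
    using dvd[OF that] cl that d by (auto simp: power_cluster_def div_greater_zero_iff intro: dvd_imp_le)
  ultimately show ?thesis
    using cl unfolding power_cluster_def g_def[symmetric] q'_def[symmetric] by auto
qed

lemma power_cluster_normalize:
  assumes cl: "power_cluster k q N S" and q: "q > 0" and S: "S \<noteq> {}"
  obtains q' S' where "power_cluster k q' N S'" "q' > 0" "card S' = card S" "Gcd S' = 1"
proof -
  define d where "d = Gcd S"
  obtain x where x: "x \<in> S" using S by blast
  have "d dvd x" "x > 0" using x cl by (auto simp: d_def power_cluster_def)
  hence d: "d > 0" by (intro gr0I) auto
  have dvd: "d dvd y" if "y \<in> S" for y using that by (simp add: d_def)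
  let ?S = "(\<lambda>x. x div d) ` S"
  have "inj_on (\<lambda>x. x div d) S"
    using dvd by (intro inj_onI) (metis dvd_div_mult_self)
  hence "card ?S = card S" by (rule card_image)
  moreover have "Gcd ?S = 1"
  proof -
    have "d * Gcd ?S dvd y" if "y \<in> S" for y
    proof -
      have "Gcd ?S dvd y div d" using that by auto
      hence "d * Gcd ?S dvd d * (y div d)" by simp
      thus ?thesis using dvd[OF that] by simp
    qed
    hence "d * Gcd ?S dvd d" by (subst (2) d_def) (rule Gcd_greatest)
    thus ?thesis using d by simp
  qed
  moreover have "q div gcd q (d ^ k) > 0" using q by (simp add: div_greater_zero_iff)
  ultimately show ?thesis using that power_cluster_div[OF cl q d dvd] by blast
qed

lemma power_cluster_coprime:
  assumes cl: "power_cluster k q N S" and "Gcd S = 1" and x: "x \<in> S" and k: "k > 0"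
  shows "coprime x q"
proof (rule ccontr)
  assume "\<not> coprime x q"
  hence "gcd x q \<noteq> 1" using coprime_iff_gcd_eq_1 by blast
  then obtain p where p: "prime p" "p dvd gcd x q" using prime_factor_nat by blast
  have "p dvd y" if y: "y \<in> S" for y
  proof -
    obtain m where m: "int y ^ k - int x ^ k = int q * m"
      using power_clusterE[OF cl y x] .
    have "int p dvd int x ^ k" using p k by (simp add: dvd_power_iff_le dvd_trans[OF _ dvd_power])
    moreover have "int p dvd int q * m" using p by simp
    ultimately have "int p dvd int x ^ k + int q * m" by (rule dvd_add)
    also have "\<dots> = int (y ^ k)" using m by simp
    finally have "p dvd y ^ k" by (simp only: int_dvd_int_iff)
    thus ?thesis using p prime_dvd_power by blast
  qed
  hence "p dvd Gcd S" by (rule Gcd_greatest)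
  thus False using p assms by simp
qed

text \<open>\<open>Gcd S = 1\<close> does not make three chosen elements jointly coprime. Their
  common divisor \<open>d\<close> is however coprime to \<open>q\<close>, because each element is,
  so dividing by \<open>d\<close> leaves the modulus intact and \<open>abc_three_powers\<close>
  bounds \<open>q\<close> itself.\<close>

lemma power_cluster_modulus_le:
  fixes K :: real
  assumes abc: "abc_bound (1 / 6) K"
    and K: "K \<ge> 1" and k: "k \<ge> 4" and q: "q > 0" and N: "N > 0"
    and cl: "power_cluster k q N S" and Gcd: "Gcd S = 1" and card: "card S \<ge> 3"
  shows "real q \<le> K ^ 8 * real N ^ 52"
proof -
  obtain T where T: "T \<subseteq> S" "card T = 3" using card by (meson obtain_subset_with_card_n)
  then obtain x y z where xyz: "T = {x, y, z}" "x \<noteq> y" "y \<noteq> z" "z \<noteq> x"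
    by (auto simp: card_3_iff)
  define d where "d = gcd x (gcd y z)"
  have clT: "power_cluster k q N {x, y, z}" using power_cluster_subset[OF cl] T xyz by blast
  have "x > 0" using clT by (simp add: power_cluster_def)
  hence d: "d > 0" by (simp add: d_def)
  have dvd: "d dvd u" if "u \<in> {x, y, z}" for u using that by (auto simp: d_def intro: dvd_trans)
  have "coprime x q" using power_cluster_coprime[OF cl Gcd] T xyz k by simp
  hence "coprime d q" using dvd[of x] coprime_divisors[of d x q q] by simp
  hence "gcd q (d ^ k) = 1" by (simp add: coprime_commute flip: coprime_iff_gcd_eq_1)
  hence cl': "power_cluster k q N ((\<lambda>u. u div d) ` {x, y, z})"
    using power_cluster_div[OF clT q d dvd] by simp
  have gcd: "gcd (x div d) (gcd (y div d) (z div d)) = 1"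
  proof -
    have "d * gcd (x div d) (gcd (y div d) (z div d))
        = gcd (d * (x div d)) (gcd (d * (y div d)) (d * (z div d)))"
      by (simp add: gcd_mult_left)
    also have "\<dots> = d * 1" using dvd by (simp add: d_def[symmetric])
    finally show ?thesis using d by simp
  qed
  have neq: "x div d \<noteq> y div d" "y div d \<noteq> z div d" "z div d \<noteq> x div d"
    using xyz dvd by (metis dvd_div_mult_self insertCI)+
  have pos: "x div d > 0" "y div d > 0" "z div d > 0"
    using cl' by (auto simp: power_cluster_def)
  obtain m1 where m1: "\<bar>m1\<bar> \<le> int N" "int (x div d) ^ k - int (y div d) ^ k = int q * m1"
    by (rule power_clusterE[OF cl', of "x div d" "y div d"]) auto
  obtain m2 where m2: "\<bar>m2\<bar> \<le> int N" "int (y div d) ^ k - int (z div d) ^ k = int q * m2"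
    by (rule power_clusterE[OF cl', of "y div d" "z div d"]) auto
  obtain m3 where m3: "\<bar>m3\<bar> \<le> int N" "int (z div d) ^ k - int (x div d) ^ k = int q * m3"
    by (rule power_clusterE[OF cl', of "z div d" "x div d"]) auto
  show ?thesis
    by (rule abc_three_powers[OF abc K k q N pos neq gcd m1(2,1) m2(2,1) m3(2,1)])
qed

text \<open>Superadditivity of the \<open>k\<close>-th power, applied to
  \<open>x = (x - y) + y\<close>.\<close>

lemma power_diff_le_diff_power:
  fixes x y :: nat
  assumes "y \<le> x" "k > 0"
  shows "(x - y) ^ k \<le> x ^ k - y ^ k"
proof -
  have "u ^ k + y ^ k \<le> (u + y) ^ k" for u
    using assms(2)
  proof (induction k rule: nat_induct_non_zero)
    case (Suc k)
    have "u ^ Suc k + y ^ Suc k \<le> (u + y) * (u ^ k + y ^ k)" by (simp add: algebra_simps)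
    also have "\<dots> \<le> (u + y) * (u + y) ^ k" using Suc by (intro mult_left_mono) auto
    finally show ?case by simp
  qed simp
  from this[of "x - y"] assms show ?thesis by simp
qed

text \<open>An element is recovered from its residue modulo \<open>q\<close>, a root of a fixed
  congruence, and the number of full blocks of length \<open>q\<close> between the minimum
  \<open>x0\<close> and it. The latter takes at most \<open>t + 1\<close> values, which is at most
  twice the \<open>k\<close>-th root of \<open>N\<close>.\<close>

lemma card_power_cluster_le:
  assumes cl: "power_cluster k q N S" and Gcd: "Gcd S = 1" and q: "q > 0" and k: "k > 0"
    and N: "N > 0" and S: "S \<noteq> {}"
  shows "real (card S) \<le> real ((2 * k) ^ card (prime_factors q)) * (2 * real N powr (1 / real k))"
proof -
  have fin: "finite S" using cl by (simp add: power_cluster_def)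
  define x0 where "x0 = Min S"
  have x0_le: "x0 \<le> x" if "x \<in> S" for x
    using fin that by (simp add: x0_def)
  have x0S: "x0 \<in> S" using fin S by (simp add: x0_def)
  define R where "R = power_roots k q (x0 ^ k)"
  define t where "t = nat \<lfloor>real N powr (1 / real k)\<rfloor>"
  have "card S \<le> card (R \<times> {..t})"
  proof (rule card_inj_on_le)
    let ?f = "\<lambda>x. (x mod q, (x - x0) div q)"
    show "inj_on ?f S"
    proof (rule inj_onI)
      fix x y assume x: "x \<in> S" and y: "y \<in> S" and eq: "?f x = ?f y"
      have "[x0 + (x - x0) = x0 + (y - x0)] (mod q)"
        using eq x0_le[OF x] x0_le[OF y] by (simp add: cong_def)
      hence "(x - x0) mod q = (y - x0) mod q" unfolding cong_add_lcancel_nat by (simp add: cong_def)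
      hence "x - x0 = y - x0" using eq by (metis div_mult_mod_eq prod.inject)
      thus "x = y" using x0_le[OF x] x0_le[OF y] by simp
    qed
    show "?f ` S \<subseteq> R \<times> {..t}"
    proof
      fix z assume "z \<in> ?f ` S"
      then obtain x where x: "x \<in> S" "z = ?f x" by blast
      obtain m where m: "\<bar>m\<bar> \<le> int N" "int x ^ k - int x0 ^ k = int q * m"
        using power_clusterE[OF cl x(1) x0S] .
      have "[int x ^ k = int x0 ^ k] (mod int q)"
        using m(2) by (simp add: cong_iff_dvd_diff)
      hence "[x ^ k = x0 ^ k] (mod q)" by (simp flip: cong_int_iff)
      hence "x mod q \<in> R" using q by (simp add: R_def power_roots_def cong_def power_mod)
      moreover have "(x - x0) div q \<le> t"
      proof -
        define s where "s = (x - x0) div q"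
        have "(s * q) ^ k \<le> (x - x0) ^ k" by (intro power_mono) (auto simp: s_def)
        also have "\<dots> \<le> x ^ k - x0 ^ k" using x0_le[OF x(1)] k by (rule power_diff_le_diff_power)
        finally have "int ((s * q) ^ k) \<le> int (x ^ k - x0 ^ k)" by (simp only: of_nat_le_iff)
        also have "\<dots> = int x ^ k - int x0 ^ k"
          using x0_le[OF x(1)] by (simp add: of_nat_diff power_mono)
        also have "\<dots> \<le> int q * int N" unfolding m(2) using m(1) by (intro mult_left_mono) auto
        finally have "(s * q) ^ k \<le> q * N" by (metis of_nat_le_iff of_nat_mult)
        \<comment> \<open>Since \<open>q ^ k \<ge> q\<close>, one factor \<open>q\<close> cancels
          against \<open>q * N\<close>, and the block count is bounded free of
          \<open>q\<close>.\<close>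
        moreover have "s ^ k * q \<le> (s * q) ^ k"
          using q k self_le_power[of q k] by (simp add: power_mult_distrib)
        ultimately have "s ^ k * q \<le> N * q" by (metis order_trans mult.commute)
        hence "s ^ k \<le> N" using q by simp
        hence "real s ^ k \<le> real N" by (metis of_nat_le_iff of_nat_power)
        hence "(real s ^ k) powr (1 / real k) \<le> real N powr (1 / real k)"
          by (intro powr_mono2) auto
        moreover have "(real s ^ k) powr (1 / real k) = real s"
          using k by (cases "s = 0") (simp_all add: powr_powr flip: powr_realpow)
        ultimately show ?thesis unfolding t_def s_def by (simp add: le_nat_floor)
      qed
      ultimately show "z \<in> R \<times> {..t}" using x by simp
    qed
  qed (simp add: R_def)
  hence "real (card S) \<le> real (card R * (t + 1))"
    by (simp only: of_nat_le_iff) (simp add: card_cartesian_product)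
  also have "\<dots> = real (card R) * (real t + 1)" by (simp add: algebra_simps)
  also have "\<dots> \<le> real ((2 * k) ^ card (prime_factors q)) * (2 * real N powr (1 / real k))"
  proof (intro mult_mono)
    have "coprime (x0 ^ k) q" using power_cluster_coprime[OF cl Gcd x0S k] by simp
    thus "real (card R) \<le> real ((2 * k) ^ card (prime_factors q))"
      unfolding R_def of_nat_le_iff using q k by (intro card_power_roots_le) auto
    have "real N powr (1 / real k) \<ge> 1" using N by (intro ge_one_powr_ge_zero) auto
    moreover have "real t \<le> real N powr (1 / real k)" unfolding t_def by simp
    ultimately show "real t + 1 \<le> 2 * real N powr (1 / real k)" by simp
  qed auto
  finally show ?thesis .
qed

subsection \<open>Powers in arithmetic progressions\<close>

lemma kth_powers_in_AP_power_cluster: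
  assumes k: "k > 0" and q: "q \<ge> 1" and a: "a \<ge> 0"
  obtains S where "power_cluster k q N S" "kth_powers_in_AP k N q a \<le> card S"
proof
  define S where "S = {x :: nat. \<exists>i\<in>{1..N}. int x ^ k = a + int i * int q}"
  have fin: "finite S"
  proof (rule finite_subset)
    show "S \<subseteq> {..nat (a + int N * int q)}"
    proof
      fix x assume "x \<in> S"
      then obtain i where i: "i \<in> {1..N}" "int x ^ k = a + int i * int q" by (auto simp: S_def)
      have "int x \<le> int x ^ k"
        using k by (cases "x = 0") (auto intro: self_le_power)
      also have "\<dots> \<le> a + int N * int q" using i by (simp add: mult_right_mono)
      finally show "x \<in> {..nat (a + int N * int q)}" by simp
    qed
  qed simp
  show "power_cluster k q N S"
    unfolding power_cluster_def
  proof (intro conjI ballI fin)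
    fix x assume "x \<in> S"
    then obtain i where i: "i \<ge> 1" "int x ^ k = a + int i * int q" by (auto simp: S_def)
    have "int i * int q > 0" using i q by simp
    hence "int x ^ k > 0" using i a by simp
    thus "x > 0" using k by (cases "x = 0") (auto simp: zero_power)
  next
    fix x y assume "x \<in> S" "y \<in> S"
    then obtain i j where ij: "i \<in> {1..N}" "int x ^ k = a + int i * int q"
      "j \<in> {1..N}" "int y ^ k = a + int j * int q" by (auto simp: S_def)
    thus "\<exists>m. \<bar>m\<bar> \<le> int N \<and> int x ^ k - int y ^ k = int q * m"
      by (intro exI[of _ "int i - int j"]) (auto simp: algebra_simps)
  qed
  have "{m \<in> (\<lambda>i. a + int i * int q) ` {1..N}. is_nth_power k m} \<subseteq> (\<lambda>x. int x ^ k) ` S"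
  proof safe
    fix i assume i: "i \<in> {1..N}" "is_nth_power k (a + int i * int q)"
    then obtain n where n: "a + int i * int q = n ^ k" by (auto elim: is_nth_powerE)
    \<comment> \<open>For even \<open>k\<close> the integer root \<open>n\<close> may be negative.
      The term is nonnegative, so the absolute value of \<open>n\<close> is a root as well.\<close>
    have "a + int i * int q = \<bar>a + int i * int q\<bar>" using a by simp
    also have "\<dots> = int (nat \<bar>n\<bar>) ^ k" unfolding n by (simp add: power_abs)
    finally show "a + int i * int q \<in> (\<lambda>x. int x ^ k) ` S"
      using i by (intro image_eqI[of _ _ "nat \<bar>n\<bar>"]) (auto simp: S_def intro!: bexI[of _ i])
  qed
  thus "kth_powers_in_AP k N q a \<le> card S"
    unfolding kth_powers_in_AP_def using fin by (rule surj_card_le[rotated])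
qed

text \<open>Makes the iterated logarithm positive from 3 on. The bound
  \<open>1 + t + t\<^sup>2\<close> for \<open>exp t\<close> gives only \<open>e \<le> 3\<close> at
  \<open>t = 1\<close>; at \<open>t = 1 / 4\<close> its fourth power is strictly below 3.\<close>

lemma ln_gt_1:
  fixes x :: real
  assumes "x \<ge> 3"
  shows "ln x > 1"
proof -
  have "exp (1::real) = exp (1 / 4) ^ 4" by (simp flip: exp_of_nat_mult)
  also have "\<dots> \<le> (1 + 1 / 4 + (1 / 4)\<^sup>2) ^ 4"
    by (intro power_mono exp_bound) auto
  also have "\<dots> < (3::real)" by (simp add: power2_eq_square field_simps)
  finally have "exp 1 < x" using assms by simp
  thus ?thesis using assms by (subst ln_exp[of 1, symmetric], subst ln_less_cancel_iff) auto
qed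

lemma kth_powers_in_AP_le_exp:
  fixes K :: real
  assumes abc: "abc_bound (1 / 6) K"
    and K: "K \<ge> 1" and k: "k \<ge> 4" and N: "N \<ge> 3" and q: "q \<ge> 1" and a: "a \<ge> 0"
  shows "real (kth_powers_in_AP k N q a) \<le> real N powr (1 / real k) *
           exp ((213 + 32 * ln K) * real k * (ln (real N) / ln (ln (real N))))"
proof -
  define L where "L = ln (real N)"
  define V where "V = L / ln L"
  define c where "c = 52 + 8 * ln K"
  have c: "c \<ge> 52" using K by (simp add: c_def)
  have L: "L > 1" using N by (simp add: L_def ln_gt_1)
  have V: "V \<ge> 1" using L ln_le_minus_one[of L] by (simp add: V_def field_simps)
  have kV: "real k * V \<ge> 1" using mult_mono[of 1 "real k" 1 V] k V by simp
  have N1: "real N powr (1 / real k) \<ge> 1" using N by (intro ge_one_powr_ge_zero) auto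
  \<comment> \<open>In \<open>5 + 4 * c\<close>, the part \<open>4 + 4 * c\<close> comes from
    \<open>2 * k \<le> exp (2 * k)\<close> raised to at most \<open>(2 + 2 * c) * V\<close> prime
    factors, and the remaining 1 pays for the factor 2 of the interval count.\<close>
  have goal: "(213 + 32 * ln K) * real k * (ln (real N) / ln (ln (real N))) = (5 + 4 * c) * (real k * V)"
    by (simp add: c_def V_def L_def)
  obtain S0 where S0: "power_cluster k q N S0" "kth_powers_in_AP k N q a \<le> card S0"
    using kth_powers_in_AP_power_cluster[of k q a N] k q a by auto
  have "real (card S0) \<le> real N powr (1 / real k) * exp ((5 + 4 * c) * (real k * V))"
  proof (cases "card S0 \<ge> 3")
    \<comment> \<open>With at most two powers ABC gives nothing, but the right side is already at
      least 2.\<close>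
    case False
    have "1 \<le> (5 + 4 * c) * (real k * V)"
      using mult_mono[of 1 "5 + 4 * c" 1 "real k * V"] c kV by simp
    hence "2 \<le> exp ((5 + 4 * c) * (real k * V))"
      using exp_ge_add_one_self[of "(5 + 4 * c) * (real k * V)"] by linarith
    hence "1 * 2 \<le> real N powr (1 / real k) * exp ((5 + 4 * c) * (real k * V))"
      using N1 by (intro mult_mono) auto
    thus ?thesis using False by simp
  next
    case True
    hence "S0 \<noteq> {}" by auto
    then obtain r S where S: "power_cluster k r N S" "r > 0" "card S = card S0" "Gcd S = 1"
      using power_cluster_normalize[OF S0(1)] q by auto
    have "S \<noteq> {}" using S(3) True by auto
    define w where "w = card (prime_factors r)"
    have "real r \<le> K ^ 8 * real N ^ 52"
      using N S True by (intro power_cluster_modulus_le[OF abc K k S(2) _ S(1,4)]) auto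
    hence "ln (real r) \<le> ln (K ^ 8 * real N ^ 52)"
      using S(2) K N by (subst ln_le_cancel_iff) auto
    also have "\<dots> = 8 * ln K + 52 * L"
      using K N by (simp add: ln_mult ln_realpow L_def)
    also have "\<dots> \<le> c * L"
      using mult_left_mono[of 1 L "8 * ln K"] K L by (simp add: c_def algebra_simps)
    finally have w: "real w \<le> (2 + 2 * c) * V"
      unfolding w_def V_def using S(2) L by (intro card_prime_factors_le_ln)
    have "real (card S) \<le> real ((2 * k) ^ w) * (2 * real N powr (1 / real k))"
      unfolding w_def using S k N \<open>S \<noteq> {}\<close> by (intro card_power_cluster_le) auto
    also have "\<dots> = real N powr (1 / real k) * (2 * (2 * real k) ^ w)" by simp
    also have "\<dots> \<le> real N powr (1 / real k) * exp ((5 + 4 * c) * (real k * V))"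
    proof (intro mult_left_mono)
      have "(2 * real k) ^ w \<le> exp (2 * real k) ^ w"
        using exp_ge_add_one_self[of "2 * real k"] by (intro power_mono) linarith+
      also have "\<dots> = exp (2 * real k * real w)" by (simp add: mult.commute flip: exp_of_nat_mult)
      also have "\<dots> \<le> exp (2 * real k * ((2 + 2 * c) * V))"
        using w by (simp add: mult_left_mono)
      finally have 1: "(2 * real k) ^ w \<le> exp (2 * real k * ((2 + 2 * c) * V))" .
      have 2: "2 \<le> exp (real k * V)"
        using exp_ge_add_one_self[of "real k * V"] kV by linarith
      have "2 * (2 * real k) ^ w \<le> exp (real k * V) * exp (2 * real k * ((2 + 2 * c) * V))"
        using 1 2 by (intro mult_mono) auto
      also have "\<dots> = exp ((5 + 4 * c) * (real k * V))"
        by (simp add: algebra_simps flip: exp_add)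
      finally show "2 * (2 * real k) ^ w \<le> exp ((5 + 4 * c) * (real k * V))" .
    qed simp
    finally show ?thesis using S(3) by simp
  qed
  thus ?thesis using S0(2) unfolding goal by linarith
qed

theorem theorem2p5:
  assumes abc_conjecture
  shows "\<exists>C::real. \<forall>k N :: nat. k \<ge> 4 \<longrightarrow> N \<ge> 1 \<longrightarrow>
           real (Qmax k N) \<le> real N powr (1 / real k) * exp (C * real k * (ln (real N) / loglog N))"
proof -
  obtain K0 where "abc_bound (1 / 6) K0"
    using assms[unfolded abc_conjecture_iff, rule_format, of "1 / 6"] by auto
  hence abc: "abc_bound (1 / 6) (max 1 K0)" by (rule abc_bound_mono) simp
  define K where "K = max 1 K0"
  note abc = abc[folded K_def]
  have K: "K \<ge> 1" by (simp add: K_def)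
  define C where "C = 213 + 32 * ln K"
  have C: "C \<ge> 1" using K by (simp add: C_def)
  have "real (Qmax k N) \<le> real N powr (1 / real k) * exp (C * real k * (ln (real N) / loglog N))"
    if k: "k \<ge> 4" and N: "N \<ge> 1" for k N
  proof -
    have "Qmax k N \<in> {kth_powers_in_AP k N q a | q a. q \<ge> 1 \<and> a \<ge> 0}"
      unfolding Qmax_def by (rule Max_in[OF finite_Qmax_set Qmax_set_nonempty])
    then obtain q a where qa: "Qmax k N = kth_powers_in_AP k N q a" "q \<ge> 1" "a \<ge> 0" by blast
    show ?thesis
    proof (cases "N \<ge> 3")
      case True
      thus ?thesis
        using kth_powers_in_AP_le_exp[OF abc K k True qa(2,3)] qa(1) by (simp add: C_def loglog_def)
    next
      case False
      \<comment> \<open>For \<open>N\<close> below 3 \<open>loglog\<close> is 1, and the trivial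
        bound \<open>N = exp (ln N)\<close> suffices because \<open>C * k \<ge> 1\<close>.\<close>
      have "1 \<le> C * real k" using mult_mono[of 1 C 1 "real k"] C k by simp
      hence "ln (real N) \<le> C * real k * ln (real N)"
        using N mult_right_mono[of 1 "C * real k" "ln (real N)"] by simp
      hence "exp (ln (real N)) \<le> exp (C * real k * ln (real N))" by simp
      hence "real N \<le> exp (C * real k * ln (real N))" using N by simp
      moreover have "real N powr (1 / real k) \<ge> 1" using N by (intro ge_one_powr_ge_zero) auto
      ultimately have "1 * real N \<le> real N powr (1 / real k) * exp (C * real k * ln (real N))"
        by (intro mult_mono) auto
      moreover have "Qmax k N \<le> N" using qa kth_powers_in_AP_le by simp
      ultimately show ?thesis using False by (simp add: loglog_def)
    qed
  qed
  thus ?thesis by blast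
qed

end
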